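(* Let $\boldsymbol{p}\subset\mathbb{R}^K$ be a box (a product of $K$ compact intervals) and let $A(\boldsymbol{p})=\{A(p)\in\mathbb{R}^{n\times n}\mid p\in\boldsymbol{p}\}$ be a symmetric parametric interval matrix, i.e. $A(p)$ is a symmetric matrix for every $p\in\boldsymbol{p}$. Then $A(\boldsymbol{p})$ is Schur stable if and only if the parametric interval matrices $$A(\boldsymbol{p})-I\quad\text{and}\quad -A(\boldsymbol{p})-I$$ are both stable.
   Context: A parametric interval matrix is a family $A(\boldsymbol{p})=\{A(p)\in\mathbb{R}^{n\times n}\mid p\in\boldsymbol{p}\}$, where the entries $A_{ij}(p)$ of $A(p)$ are real-valued functions of the parameter vector $p=(p_1,\dots,p_K)$. $I$ is the identity matrix, and $A(\boldsymbol{p})-I$ and $-A(\boldsymbol{p})-I$ denote the families $\{A(p)-I\mid p\in\boldsymbol{p}\}$ and $\{-A(p)-I\mid p\in\boldsymbol{p}\}$. A real square matrix is stable (Hurwitz) if every eigenvalue has strictly negative real part, and Schur stable if $|\lambda|<1$ for each eigenvalue $\lambda$. A parametric interval matrix is stable (respectively Schur stable) if each of its members, over all $p\in\boldsymbol{p}$, is stable (respectively Schur stable). *)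

theory Defs
  imports "Jordan_Normal_Form.Char_Poly" "HOL.Complex"
begin

definition is_box :: "nat \<Rightarrow> real vec set \<Rightarrow> bool" where
  "is_box K P \<longleftrightarrow>
     (\<exists>l u :: nat \<Rightarrow> real. (\<forall>i<K. l i \<le> u i) \<and>
        P = {p \<in> carrier_vec K. \<forall>i<K. p $ i \<in> {l i..u i}})"

(* The eigenvalues of a real square matrix are its complex ones, so the matrix is mapped into
   the complex matrices first. Both predicates are meant for square matrices only. *)

definition stable_mat :: "real mat \<Rightarrow> bool" where
  "stable_mat M \<longleftrightarrow> (\<forall>z. eigenvalue (map_mat complex_of_real M) z \<longrightarrow> Re z < 0)"

definition schur_stable_mat :: "real mat \<Rightarrow> bool" where
  "schur_stable_mat M \<longleftrightarrow> (\<forall>z. eigenvalue (map_mat complex_of_real M) z \<longrightarrow> cmod z < 1)"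

definition symmetric_mat :: "'a mat \<Rightarrow> bool" where
  "symmetric_mat M \<longleftrightarrow> transpose_mat M = M"

(* A parametric interval matrix is the set {A p | p. p \<in> P} of its members. *)

definition stable_family :: "real mat set \<Rightarrow> bool" where
  "stable_family F \<longleftrightarrow> (\<forall>M\<in>F. stable_mat M)"

definition schur_stable_family :: "real mat set \<Rightarrow> bool" where
  "schur_stable_family F \<longleftrightarrow> (\<forall>M\<in>F. schur_stable_mat M)"

end

theory Submission
  imports Defs
begin

text \<open>Eigenvalues move with the matrix: those of \<open>A - I\<close> are the \<open>\<lambda> - 1\<close> and those of
  \<open>- A - I\<close> are the \<open>- \<lambda> - 1\<close>, where \<open>\<lambda>\<close> runs over the eigenvalues of \<open>A\<close>. Hence the two
  shifted matrices are stable if and only if every \<open>\<lambda>\<close> lies in the strip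
  \<open>-1 < Re \<lambda> < 1\<close> (lemma \<open>stable_shifts_iff\<close>). This strip is larger than the open unit disc
  that defines Schur stability, but both meet the real axis in the same interval, and symmetry
  puts every eigenvalue on the real axis (lemmas \<open>hermitian_eigenvalue_real\<close> and
  \<open>symmetric_eigenvalue_real\<close>). The equivalence thus holds for each single matrix, and it passes
  to a family by quantifying over the members.\<close>

lemma conjugate_mult_mat_vec:
  fixes H :: "complex mat"
  assumes "v \<in> carrier_vec (dim_col H)"
  shows "conjugate (H *\<^sub>v v) = map_mat cnj H *\<^sub>v conjugate v"
  using assms by (intro eq_vecI) (auto simp: scalar_prod_def)

text \<open>For an eigenvector \<open>v\<close>, moving \<open>H\<close> from one side of the inner product of \<open>v\<close> with itself
  to the other turns \<open>z * (v \<bullet>c v)\<close> into \<open>cnj z * (v \<bullet>c v)\<close>, and \<open>v \<bullet>c v\<close> is not zero.\<close>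

lemma hermitian_eigenvalue_real:
  assumes H: "H \<in> carrier_mat n n"
    and herm: "transpose_mat (map_mat cnj H) = H"
    and ev: "eigenvalue H z"
  shows "z \<in> \<real>"
proof -
  obtain v where v: "v \<in> carrier_vec n" "v \<noteq> 0\<^sub>v n" and Hv: "H *\<^sub>v v = z \<cdot>\<^sub>v v"
    using ev H unfolding eigenvalue_def eigenvector_def by auto
  have "z * (v \<bullet>c v) = (H *\<^sub>v v) \<bullet>c v"
    using v by (simp add: Hv)
  also have "\<dots> = (transpose_mat (map_mat cnj H) *\<^sub>v v) \<bullet>c v"
    by (simp add: herm)
  also have "\<dots> = v \<bullet> (map_mat cnj H *\<^sub>v conjugate v)"
    using H v by (intro transpose_vec_mult_scalar[where nr = n and nc = n]) auto
  also have "\<dots> = v \<bullet>c (H *\<^sub>v v)"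
    using H v by (subst conjugate_mult_mat_vec) auto
  also have "\<dots> = cnj z * (v \<bullet>c v)"
    using v by (simp add: Hv conjugate_smult_vec)
  finally have "z = cnj z"
    using v by simp
  then show ?thesis
    by (metis Reals_cnj_iff)
qed

lemma symmetric_eigenvalue_real:
  assumes M: "M \<in> carrier_mat n n"
    and sym: "symmetric_mat M"
    and ev: "eigenvalue (map_mat complex_of_real M) z"
  shows "z \<in> \<real>"
proof (rule hermitian_eigenvalue_real[OF _ _ ev])
  show "map_mat complex_of_real M \<in> carrier_mat n n"
    using M by simp
  have "map_mat cnj (map_mat complex_of_real M) = map_mat complex_of_real M"
    by (rule eq_matI) auto
  then show "transpose_mat (map_mat cnj (map_mat complex_of_real M)) = map_mat complex_of_real M"
    using sym by (simp add: symmetric_mat_def map_mat_transpose)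
qed

lemma eigenvalue_uminus:
  fixes M :: "'a :: comm_ring_1 mat"
  assumes M: "M \<in> carrier_mat n n"
  shows "eigenvalue (- M) w \<longleftrightarrow> eigenvalue M (- w)"
proof -
  have "- M *\<^sub>v v = w \<cdot>\<^sub>v v \<longleftrightarrow> M *\<^sub>v v = (- w) \<cdot>\<^sub>v v" if v: "v \<in> carrier_vec n" for v
  proof -
    have "- M *\<^sub>v v = - (M *\<^sub>v v)"
      using M v by simp
    moreover have "(- w) \<cdot>\<^sub>v v = - (w \<cdot>\<^sub>v v)"
      by (rule eq_vecI) auto
    ultimately show ?thesis
      by (metis uminus_uminus_vec)
  qed
  then have "eigenvector (- M) v w \<longleftrightarrow> eigenvector M v (- w)" for v
    using M by (auto simp: eigenvector_def)
  then show ?thesis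
    by (simp add: eigenvalue_def)
qed

lemma eigenvalue_minus_one:
  fixes M :: "'a :: comm_ring_1 mat"
  assumes M: "M \<in> carrier_mat n n"
  shows "eigenvalue (M - 1\<^sub>m n) w \<longleftrightarrow> eigenvalue M (w + 1)"
proof -
  have "(M - 1\<^sub>m n) *\<^sub>v v = w \<cdot>\<^sub>v v \<longleftrightarrow> M *\<^sub>v v = (w + 1) \<cdot>\<^sub>v v" if v: "v \<in> carrier_vec n" for v
  proof -
    have "(M - 1\<^sub>m n) *\<^sub>v v = M *\<^sub>v v - v"
      using M v by (simp add: minus_mult_distrib_mat_vec[where nr = n and nc = n])
    then show ?thesis
      using M v by (auto simp: vec_eq_iff algebra_simps)
  qed
  then have "eigenvector (M - 1\<^sub>m n) v w \<longleftrightarrow> eigenvector M v (w + 1)" for v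
    using M by (auto simp: eigenvector_def)
  then show ?thesis
    by (simp add: eigenvalue_def)
qed

lemma stable_shifts_iff:
  assumes M: "M \<in> carrier_mat n n"
  shows "stable_mat (M - 1\<^sub>m n) \<and> stable_mat (- M - 1\<^sub>m n) \<longleftrightarrow>
    (\<forall>z. eigenvalue (map_mat complex_of_real M) z \<longrightarrow> \<bar>Re z\<bar> < 1)"
proof -
  let ?C = "map_mat complex_of_real M"
  have C: "?C \<in> carrier_mat n n"
    using M by simp
  have maps: "map_mat complex_of_real (M - 1\<^sub>m n) = ?C - 1\<^sub>m n"
    "map_mat complex_of_real (- M - 1\<^sub>m n) = - ?C - 1\<^sub>m n"
    using M by (auto intro!: eq_matI)
  have "stable_mat (M - 1\<^sub>m n) \<longleftrightarrow> (\<forall>w. eigenvalue ?C (w + 1) \<longrightarrow> Re w < 0)"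
    unfolding stable_mat_def maps eigenvalue_minus_one[OF C] ..
  also have "\<dots> \<longleftrightarrow> (\<forall>z. eigenvalue ?C z \<longrightarrow> Re z < 1)"
  proof (intro iffI allI impI)
    fix z
    assume "\<forall>w. eigenvalue ?C (w + 1) \<longrightarrow> Re w < 0" "eigenvalue ?C z"
    from this(1)[rule_format, of "z - 1"] this(2) show "Re z < 1"
      by simp
  next
    fix w
    assume "\<forall>z. eigenvalue ?C z \<longrightarrow> Re z < 1" "eigenvalue ?C (w + 1)"
    then have "Re (w + 1) < 1"
      by blast
    then show "Re w < 0"
      by simp
  qed
  finally have upper: "stable_mat (M - 1\<^sub>m n) \<longleftrightarrow> (\<forall>z. eigenvalue ?C z \<longrightarrow> Re z < 1)" .
  have "stable_mat (- M - 1\<^sub>m n) \<longleftrightarrow> (\<forall>w. eigenvalue ?C (- (w + 1)) \<longrightarrow> Re w < 0)"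
    unfolding stable_mat_def maps eigenvalue_minus_one[OF uminus_carrier_mat[OF C]]
      eigenvalue_uminus[OF C] ..
  also have "\<dots> \<longleftrightarrow> (\<forall>z. eigenvalue ?C z \<longrightarrow> - 1 < Re z)"
  proof (intro iffI allI impI)
    fix z
    assume "\<forall>w. eigenvalue ?C (- (w + 1)) \<longrightarrow> Re w < 0" "eigenvalue ?C z"
    from this(1)[rule_format, of "- z - 1"] this(2) show "- 1 < Re z"
      by simp
  next
    fix w
    assume "\<forall>z. eigenvalue ?C z \<longrightarrow> - 1 < Re z" "eigenvalue ?C (- (w + 1))"
    then have "- 1 < Re (- (w + 1))"
      by blast
    then show "Re w < 0"
      by simp
  qed
  finally have lower: "stable_mat (- M - 1\<^sub>m n) \<longleftrightarrow> (\<forall>z. eigenvalue ?C z \<longrightarrow> - 1 < Re z)" .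
  show ?thesis
    unfolding upper lower by (auto simp: abs_less_iff)
qed

lemma symmetric_schur_stable_iff:
  assumes M: "M \<in> carrier_mat n n" and sym: "symmetric_mat M"
  shows "schur_stable_mat M \<longleftrightarrow> stable_mat (M - 1\<^sub>m n) \<and> stable_mat (- M - 1\<^sub>m n)"
proof -
  have "cmod z = \<bar>Re z\<bar>" if "eigenvalue (map_mat complex_of_real M) z" for z
    using symmetric_eigenvalue_real[OF M sym that] by (simp add: in_Reals_norm)
  then show ?thesis
    unfolding stable_shifts_iff[OF M] schur_stable_mat_def by auto
qed

theorem theorem5p2:
  fixes n K :: nat and P :: "real vec set" and A :: "real vec \<Rightarrow> real mat"
  assumes "is_box K P"
    and "\<And>p. p \<in> P \<Longrightarrow> A p \<in> carrier_mat n n"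
    and "\<And>p. p \<in> P \<Longrightarrow> symmetric_mat (A p)"
  shows "schur_stable_family {A p | p. p \<in> P} \<longleftrightarrow>
    stable_family {A p - 1\<^sub>m n | p. p \<in> P} \<and> stable_family {- A p - 1\<^sub>m n | p. p \<in> P}"
  unfolding schur_stable_family_def stable_family_def
  using symmetric_schur_stable_iff[OF assms(2,3)] by blast

end
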